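(* Let $p,q$ be complex numbers. The generating function of the odd-indexed $(p,q)$-Jacobsthal Lucas numbers is, as a formal power series in $z$, $$\sum_{n=0}^{\infty}j_{p,q,2n+1}z^n=\frac{p+2pqz}{1-(p^2+4q)z+4q^2z^2}.$$
   Context: The $(p,q)$-Jacobsthal Lucas numbers are defined by $j_{p,q,0}=2$, $j_{p,q,1}=p$, and $j_{p,q,n}=pj_{p,q,n-1}+2qj_{p,q,n-2}$ for $n\ge 2$. *)

theory Defs
  imports Complex_Main "HOL-Computational_Algebra.Formal_Power_Series"
begin

fun jacobsthal_lucas :: "complex \<Rightarrow> complex \<Rightarrow> nat \<Rightarrow> complex" where
  "jacobsthal_lucas p q 0 = 2"
| "jacobsthal_lucas p q (Suc 0) = p"
| "jacobsthal_lucas p q (Suc (Suc n)) =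
     p * jacobsthal_lucas p q (Suc n) + 2 * q * jacobsthal_lucas p q n"

end

theory Submission
  imports Defs
begin

text \<open>If a, b are the roots of x^2 = p x + 2 q, then a^2 + b^2 = p^2 + 4 q and a^2 b^2 = 4
  q^2, so every second term obeys the recurrence \<open>jacobsthal_lucas_step_two\<close>. The
  denominator encodes it: the product with the series vanishes from degree 2 on.\<close>

lemma jacobsthal_lucas_step_two:
  "jacobsthal_lucas p q (n + 4) =
    (p^2 + 4 * q) * jacobsthal_lucas p q (n + 2) - 4 * q^2 * jacobsthal_lucas p q n"
  by (simp add: numeral_eq_Suc algebra_simps)

theorem theorem11:
  fixes p q :: complex
  shows "Abs_fps (\<lambda>n. jacobsthal_lucas p q (2 * n + 1)) =
    (fps_const p + fps_const (2 * p * q) * fps_X) /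
    (1 - fps_const (p^2 + 4 * q) * fps_X + fps_const (4 * q^2) * fps_X^2)"
    (is "?F = ?N / ?D")
proof -
  have "fps_nth ?D 0 = 1"
    by simp
  then have "?D \<noteq> 0"
    by (metis fps_zero_nth zero_neq_one)
  \<comment> \<open>Each factor \<open>fps_X\<close> now stands in front as an index shift, so
    coefficients can be read off.\<close>
  have expand: "?F * ?D = ?F - fps_const (p^2 + 4 * q) * (fps_X * ?F)
      + fps_const (4 * q^2) * (fps_X * (fps_X * ?F))"
    by (simp add: algebra_simps power2_eq_square)
  have "fps_nth (?F * ?D) n = fps_nth ?N n" for n
  proof -
    consider "n = 0" | "n = 1" | m where "n = Suc (Suc m)"
      by (metis One_nat_def not0_implies_Suc)
    then show ?thesis
    proof cases
      case 1
      then show ?thesis by (simp add: expand)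
    next
      \<comment> \<open>Here j_3 - (p^2 + 4 q) j_1 = 2 p q.\<close>
      case 2
      then show ?thesis
        unfolding expand by (simp add: numeral_eq_Suc algebra_simps)
    next
      case (3 m)
      then show ?thesis
        \<comment> \<open>Coefficients m, m + 1, m + 2 of the series are the terms 2 m + 1, 2 m + 3,
          2 m + 5.\<close>
        using jacobsthal_lucas_step_two[of p q "2 * m + 1"]
        unfolding expand by (simp add: eval_nat_numeral)
    qed
  qed
  then have "?F * ?D = ?N"
    by (rule fps_ext)
  with \<open>?D \<noteq> 0\<close> show ?thesis
    by (metis nonzero_mult_div_cancel_right)
qed

end
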